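(* Let $T$ be a finite tree with $n\geq 3$ vertices and diameter $D$, with its set of leaves as boundary. Then $$\lambda_1(T)\ \leq\ \frac{n}{D-1}-1,$$ and equality holds if and only if all interior vertices lie on a single diametral path (a path of length $D$ in $T$) and all interior vertices are adjacent to an equal number of leaves.
   Context: For a finite tree $T=(V,E)$ with at least three vertices, the boundary $B$ is the set of leaves (degree-one vertices) and the interior is $\Omega=V\setminus B$. The first Dirichlet eigenvalue $\lambda_1(T)=\lambda_1(T,B)$ is the smallest $\lambda$ for which there is a nonzero $f:V\to\mathbb{R}$ with $f=0$ on $B$ and $\sum_{y\sim x}(f(x)-f(y))=\lambda f(x)$ for all $x\in\Omega$. Equivalently, $\lambda_1(T)=\min \frac{\sum_{\{x,y\}\in E}(f(x)-f(y))^2}{\sum_{x\in\Omega}f(x)^2}$ over nonzero $f:V\to\mathbb{R}$ vanishing on $B$. The diameter is $D=\max_{v,w\in V}\mathrm{dist}(v,w)$. *)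

theory Defs
  imports
    Complex_Main
    "Graph_Theory.Graph_Theory"
    "Graph_Theory.Shortest_Path"
begin

text \<open>
  Finite simple graphs are symmetric digraphs (locale \<^locale>\<open>graph\<close>): every edge is
  represented by its two opposite arcs, and \<^term>\<open>u \<rightarrow>\<^bsub>G\<^esub> v\<close> is adjacency.

  The constant \<^const>\<open>tree\<close> of the library is not usable for such graphs, because an arc
  followed by its reverse counts as a \<^const>\<open>pre_digraph.cycle\<close>.  The directed cycles of length
  at least 3 are exactly the oriented cycles of the undirected graph.
\<close>

definition undirected_tree :: "('a, 'b) pre_digraph \<Rightarrow> bool" where
  "undirected_tree G \<longleftrightarrow>
     graph G \<and> Digraph_Component.connected G \<and>
     (\<nexists>p. pre_digraph.cycle G p \<and> 3 \<le> length p)"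

definition leaves :: "('a, 'b) pre_digraph \<Rightarrow> 'a set" where
  "leaves G = {v \<in> verts G. out_degree G v = 1}"

definition interior_verts :: "('a, 'b) pre_digraph \<Rightarrow> 'a set" where
  "interior_verts G = verts G - leaves G"

definition graph_dist :: "('a, 'b) pre_digraph \<Rightarrow> 'a \<Rightarrow> 'a \<Rightarrow> nat" where
  "graph_dist G u v = (LEAST k. \<exists>p. pre_digraph.awalk G u p v \<and> length p = k)"

definition graph_diameter :: "('a, 'b) pre_digraph \<Rightarrow> nat" where
  "graph_diameter G = Max {graph_dist G u v | u v. u \<in> verts G \<and> v \<in> verts G}"

definition dirichlet_eigenvalue :: "('a, 'b) pre_digraph \<Rightarrow> 'a set \<Rightarrow> real \<Rightarrow> bool" where
  "dirichlet_eigenvalue G B l \<longleftrightarrow>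
     (\<exists>f :: 'a \<Rightarrow> real.
        (\<exists>x \<in> verts G. f x \<noteq> 0) \<and>
        (\<forall>x \<in> B. f x = 0) \<and>
        (\<forall>x \<in> verts G - B. (\<Sum>y \<in> {y \<in> verts G. x \<rightarrow>\<^bsub>G\<^esub> y}. f x - f y) = l * f x))"

definition dirichlet_lambda1 :: "('a, 'b) pre_digraph \<Rightarrow> 'a set \<Rightarrow> real" where
  "dirichlet_lambda1 G B = (LEAST l. dirichlet_eigenvalue G B l)"

text \<open>Paths are given by their arc lists, so \<^term>\<open>length p\<close> is the number of edges.\<close>

definition diametral_path :: "('a, 'b) pre_digraph \<Rightarrow> 'a \<Rightarrow> 'b awalk \<Rightarrow> 'a \<Rightarrow> bool" where
  "diametral_path G u p v \<longleftrightarrow> pre_digraph.apath G u p v \<and> length p = graph_diameter G"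

definition leaf_neighbours :: "('a, 'b) pre_digraph \<Rightarrow> 'a \<Rightarrow> 'a set" where
  "leaf_neighbours G x = {y \<in> leaves G. x \<rightarrow>\<^bsub>G\<^esub> y}"

text \<open>The distance is the library's shortest-path cost for unit weights.\<close>

lemma (in wf_digraph) graph_dist_eq_mu:
  assumes "u \<rightarrow>\<^sup>*\<^bsub>G\<^esub> v"
  shows "ereal (real (graph_dist G u v)) = \<mu> (\<lambda>_. 1) u v"
proof -
  have cost: "awalk_cost (\<lambda>_. 1) p = real (length p)" for p
    by (induct p) auto
  have "\<exists>k p. awalk u p v \<and> length p = k"
    using assms by (auto simp: reachable_awalk)
  from LeastI_ex[OF this] obtain p
    where p: "awalk u p v" "length p = graph_dist G u v"
    unfolding graph_dist_def by blast
  have le: "graph_dist G u v \<le> length q" if "awalk u q v" for q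
    unfolding graph_dist_def using that by (intro Least_le) blast
  have "(INF q\<in>{q. awalk u q v}. ereal (real (length q))) = ereal (real (graph_dist G u v))"
  proof (rule antisym)
    show "(INF q\<in>{q. awalk u q v}. ereal (real (length q))) \<le> ereal (real (graph_dist G u v))"
      using p by (intro INF_lower2[of p]) auto
    show "ereal (real (graph_dist G u v)) \<le> (INF q\<in>{q. awalk u q v}. ereal (real (length q)))"
      by (intro INF_greatest) (use le in auto)
  qed
  then show ?thesis by (simp add: \<mu>_def cost)
qed

end

theory Submission
  imports Defs "HOL-Analysis.Function_Topology"
begin

text \<open>
  Inserting the indicator function of the interior \<open>\<Omega>\<close> into the Rayleigh quotient gives
  \<open>\<lambda>\<^sub>1 \<le> (n - \<bar>\<Omega>\<bar>) / \<bar>\<Omega>\<bar>\<close>, because each leaf is attached to exactly one interior vertex. The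
  bound follows, since a diametral path has \<open>D - 1\<close> inner vertices, all of them interior.
  Equality forces \<open>\<bar>\<Omega>\<bar> = D - 1\<close> and makes the indicator function a minimiser, hence an
  eigenfunction, and its Laplacian at an interior vertex counts the adjacent leaves. Conversely, if
  each interior vertex has \<open>k\<close> leaves, then the edges at the boundary alone contribute
  \<open>k \<Sum>g\<^sup>2\<close> to the energy of \<open>g\<close>, so that \<open>\<lambda>\<^sub>1 \<ge> k\<close>.
\<close>

subsection \<open>The Rayleigh quotient\<close>

definition (in pre_digraph) nbrs :: "'a \<Rightarrow> 'a set" where
  "nbrs x = {y \<in> verts G. x \<rightarrow>\<^bsub>G\<^esub> y}"

text \<open>Each undirected edge is met twice, once from either end; halving gives the sum over
  edges.\<close>

definition (in pre_digraph) energy :: "('a \<Rightarrow> real) \<Rightarrow> real" where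
  "energy f = (\<Sum>x\<in>verts G. \<Sum>y\<in>nbrs x. (f x - f y)\<^sup>2) / 2"

definition (in pre_digraph) laplacian :: "('a \<Rightarrow> real) \<Rightarrow> 'a \<Rightarrow> real" where
  "laplacian f x = (\<Sum>y\<in>nbrs x. f x - f y)"

definition (in pre_digraph) sq_norm :: "('a \<Rightarrow> real) \<Rightarrow> real" where
  "sq_norm f = (\<Sum>x\<in>verts G. (f x)\<^sup>2)"

lemma dirichlet_eigenvalue_iff:
  "dirichlet_eigenvalue G B l \<longleftrightarrow>
     (\<exists>f. (\<exists>x\<in>verts G. f x \<noteq> 0) \<and> (\<forall>x\<in>B. f x = 0) \<and>
       (\<forall>x\<in>verts G - B. pre_digraph.laplacian G f x = l * f x))"
  unfolding dirichlet_eigenvalue_def pre_digraph.laplacian_def pre_digraph.nbrs_def ..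

text \<open>For small \<open>t\<close> of sign opposite to \<open>b\<close> the linear term would
  outweigh the quadratic one. This is the first-variation argument for minimisers.\<close>

lemma linear_coeff_zero_if_nonneg:
  fixes a b :: real
  assumes "\<And>t. 0 \<le> t * b + t\<^sup>2 * a"
  shows "b = 0"
proof (rule ccontr)
  assume "b \<noteq> 0"
  \<comment> \<open>Any positive number above \<open>a\<close> works: at \<open>t = - b / c\<close>
    the quadratic equals \<open>b\<^sup>2 * (a - c) / c\<^sup>2\<close>.\<close>
  define c where "c = \<bar>a\<bar> + 1"
  have "c > 0" by (simp add: c_def)
  have "0 \<le> (- b / c) * b + (- b / c)\<^sup>2 * a" by (rule assms)
  also have "\<dots> = b\<^sup>2 * (a - c) / c\<^sup>2"
    using \<open>c > 0\<close> by (simp add: power2_eq_square field_simps)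
  also have "\<dots> < 0"
    using \<open>c > 0\<close> \<open>b \<noteq> 0\<close> by (intro divide_neg_pos mult_pos_neg) (auto simp: c_def)
  finally show False by simp
qed

context pseudo_graph
begin

lemma finite_nbrs [simp]: "finite (nbrs x)"
  by (simp add: nbrs_def)

lemma dominates_sym: "x \<rightarrow>\<^bsub>G\<^esub> y \<Longrightarrow> y \<rightarrow>\<^bsub>G\<^esub> x"
  using arcs_ends_symmetric[OF sym_arcs] .

lemma sum_nbrs_swap:
  fixes h :: "'a \<Rightarrow> 'a \<Rightarrow> real"
  shows "(\<Sum>x\<in>verts G. \<Sum>y\<in>nbrs x. h x y) = (\<Sum>x\<in>verts G. \<Sum>y\<in>nbrs x. h y x)"
proof -
  have "(\<Sum>x\<in>verts G. \<Sum>y\<in>nbrs x. h x y) =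
      (\<Sum>y\<in>verts G. \<Sum>x\<in>{x \<in> verts G. x \<rightarrow>\<^bsub>G\<^esub> y}. h x y)"
    unfolding nbrs_def by (rule sum.swap_restrict) auto
  also have "\<dots> = (\<Sum>y\<in>verts G. \<Sum>x\<in>nbrs y. h x y)"
    unfolding nbrs_def using dominates_sym by (intro sum.cong) auto
  finally show ?thesis .
qed

text \<open>Summation by parts: the product of differences splits into two terms that the exchange
  of \<open>x\<close> and \<open>y\<close> turns into each other, each giving the sum on the
  left.\<close>

lemma green:
  "(\<Sum>x\<in>verts G. g x * laplacian f x) =
     (\<Sum>x\<in>verts G. \<Sum>y\<in>nbrs x. (g x - g y) * (f x - f y)) / 2"
proof -
  let ?S = "\<lambda>h. \<Sum>x\<in>verts G. \<Sum>y\<in>nbrs x. h x y"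
  have "?S (\<lambda>x y. (g x - g y) * (f x - f y)) =
      ?S (\<lambda>x y. g x * (f x - f y)) + ?S (\<lambda>x y. g y * (f y - f x))"
    by (simp add: algebra_simps flip: sum.distrib)
  also have "?S (\<lambda>x y. g y * (f y - f x)) = ?S (\<lambda>x y. g x * (f x - f y))"
    by (rule sum_nbrs_swap)
  finally show ?thesis unfolding laplacian_def sum_distrib_left by simp
qed

lemma energy_eq_sum_laplacian: "energy f = (\<Sum>x\<in>verts G. f x * laplacian f x)"
  unfolding green energy_def by (simp add: power2_eq_square)

text \<open>Nothing is known about the Laplacian on \<open>B\<close>, but there the factor
  \<open>f x\<close> removes it from \<open>energy_eq_sum_laplacian\<close>.\<close>

lemma eigenfunction_energy:
  assumes "\<forall>x\<in>B. f x = 0" and "\<forall>x\<in>verts G - B. laplacian f x = l * f x"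
  shows "energy f = l * sq_norm f"
proof -
  have "f x * laplacian f x = l * (f x)\<^sup>2" if "x \<in> verts G" for x
    using assms that by (cases "x \<in> B") (auto simp: power2_eq_square)
  then show ?thesis by (simp add: energy_eq_sum_laplacian sq_norm_def sum_distrib_left)
qed

lemma sq_norm_pos:
  assumes "x \<in> verts G" and "f x \<noteq> 0"
  shows "sq_norm f > 0"
  unfolding sq_norm_def using assms by (intro sum_pos2[of _ x]) auto

lemma energy_add_scaled:
  "energy (\<lambda>y. f y + t * g y) =
     energy f + 2 * t * (\<Sum>x\<in>verts G. g x * laplacian f x) + t\<^sup>2 * energy g"
proof -
  have "((f x + t * g x) - (f y + t * g y))\<^sup>2 =
      (f x - f y)\<^sup>2 + 2 * t * ((g x - g y) * (f x - f y)) + t\<^sup>2 * (g x - g y)\<^sup>2" for x y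
    by (simp add: power2_eq_square algebra_simps)
  then show ?thesis
    unfolding green energy_def by (simp add: sum.distrib add_divide_distrib flip: sum_distrib_left)
qed

lemma sq_norm_add_scaled:
  "sq_norm (\<lambda>y. f y + t * g y) = sq_norm f + 2 * t * (\<Sum>x\<in>verts G. g x * f x) + t\<^sup>2 * sq_norm g"
proof -
  have "(f x + t * g x)\<^sup>2 = (f x)\<^sup>2 + 2 * t * (g x * f x) + t\<^sup>2 * (g x)\<^sup>2" for x
    by (simp add: power2_eq_square algebra_simps)
  then show ?thesis
    unfolding sq_norm_def by (simp add: sum.distrib flip: sum_distrib_left)
qed

text \<open>Perturbing \<open>f\<close> at the single vertex \<open>z\<close> keeps the boundary
  values. The excess of the energy over \<open>m * sq_norm\<close> is then a nonnegative quadratic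
  in \<open>t\<close> without constant term, so its linear coefficient vanishes.\<close>

lemma minimiser_eigenfunction:
  assumes le: "\<And>g. \<forall>x\<in>B. g x = 0 \<Longrightarrow> m * sq_norm g \<le> energy g"
    and f: "\<forall>x\<in>B. f x = 0" and eq: "energy f = m * sq_norm f"
    and z: "z \<in> verts G - B"
  shows "laplacian f z = m * f z"
proof -
  define \<delta> where "\<delta> x = (if x = z then 1 else 0 :: real)" for x
  have pick: "(\<Sum>x\<in>verts G. \<delta> x * h x) = h z" for h
  proof -
    have "(\<Sum>x\<in>verts G. \<delta> x * h x) = (\<Sum>x\<in>verts G. if z = x then h x else 0)"
      by (rule sum.cong) (auto simp: \<delta>_def)
    then show ?thesis using z by simp
  qed
  have "0 \<le> t * (2 * (laplacian f z - m * f z)) + t\<^sup>2 * (energy \<delta> - m * sq_norm \<delta>)" for t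
  proof -
    have "m * sq_norm (\<lambda>x. f x + t * \<delta> x) \<le> energy (\<lambda>x. f x + t * \<delta> x)"
      using f z by (intro le) (auto simp: \<delta>_def)
    then show ?thesis
      unfolding energy_add_scaled sq_norm_add_scaled pick eq by (simp add: algebra_simps)
  qed
  from linear_coeff_zero_if_nonneg[OF this] show ?thesis by simp
qed

text \<open>The continuous energy attains its minimum on a compact unit sphere, and homogeneity
  carries the inequality over to every admissible \<open>g\<close>.\<close>

lemma ex_minimiser:
  assumes "verts G - B \<noteq> {}"
  obtains f where "\<forall>x\<in>B. f x = 0" "sq_norm f = 1"
    "\<And>g. \<forall>x\<in>B. g x = 0 \<Longrightarrow> energy f * sq_norm g \<le> energy g"
proof -
  \<comment> \<open>Functions are total on a possibly infinite type. The factor {0} away from the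
    interior keeps the product compact by Tychonoff; elsewhere [-1, 1] loses nothing, as
    \<open>sq_norm f = 1\<close> bounds every value.\<close>
  define I where "I x = (if x \<in> verts G - B then {-1..1} else {0 :: real})" for x
  define K where "K = PiE UNIV I \<inter> {f. sq_norm f = 1}"
  have K_iff: "f \<in> K \<longleftrightarrow> (\<forall>x. f x \<in> I x) \<and> sq_norm f = 1" for f
    by (auto simp: K_def PiE_def Pi_def)
  have cont: "continuous_on S (\<lambda>f :: 'a \<Rightarrow> real. f x)" for S x
    by (rule continuous_on_subset[OF continuous_on_product_coordinates]) auto
  have "compact (I x)" for x
    by (simp add: I_def)
  then have "compact (PiE UNIV I)"
    using compactin_PiE[of "\<lambda>_. euclidean" UNIV I]
    by (simp add: euclidean_product_topology)
  moreover have "closed {f :: 'a \<Rightarrow> real. sq_norm f = 1}"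
    unfolding sq_norm_def by (intro closed_Collect_eq continuous_intros cont)
  ultimately have K: "compact K"
    unfolding K_def by (rule compact_Int_closed)
  have normalised: "(\<lambda>x. if x \<in> verts G - B then g x / sqrt (sq_norm g) else 0) \<in> K"
    if g: "sq_norm g > 0" "\<forall>x\<in>B. g x = 0" for g
  proof -
    have "\<bar>g x\<bar> \<le> sqrt (sq_norm g)" if "x \<in> verts G" for x
    proof -
      have "(g x)\<^sup>2 \<le> sq_norm g"
        unfolding sq_norm_def using that by (intro member_le_sum) auto
      then show ?thesis using real_sqrt_le_mono by fastforce
    qed
    then have "\<bar>g x / sqrt (sq_norm g)\<bar> \<le> 1" if "x \<in> verts G" for x
      using that g by (simp add: divide_le_eq)
    then have bd: "g x / sqrt (sq_norm g) \<in> {-1..1}" if "x \<in> verts G" for x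
      using that by (force simp: abs_le_iff minus_le_iff simp del: abs_divide)
    have "sq_norm (\<lambda>x. if x \<in> verts G - B then g x / sqrt (sq_norm g) else 0) =
        (\<Sum>x\<in>verts G. (g x)\<^sup>2 / sq_norm g)"
      unfolding sq_norm_def[of "\<lambda>x. if _ x then _ x else _"]
      using g by (intro sum.cong) (auto simp: power_divide)
    also have "\<dots> = 1"
      using g by (simp add: sq_norm_def flip: sum_divide_distrib)
    finally show ?thesis using bd by (auto simp: K_iff I_def)
  qed
  obtain z where z: "z \<in> verts G - B" using assms by blast
  have "(\<lambda>x. if x \<in> verts G - B then (if x = z then 1 else 0) / sqrt (sq_norm (\<lambda>x. if x = z then 1 else 0)) else 0) \<in> K"
    using z by (intro normalised sq_norm_pos[of z]) auto
  then have "K \<noteq> {}" by blast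
  moreover have "continuous_on K energy"
    unfolding energy_def by (intro continuous_intros cont) simp
  ultimately obtain f where f: "f \<in> K" "\<And>h. h \<in> K \<Longrightarrow> energy f \<le> energy h"
    using continuous_attains_inf[OF K] by blast
  show ?thesis
  proof (rule that)
    show "\<forall>x\<in>B. f x = 0" "sq_norm f = 1"
      using f(1) by (auto simp: K_iff I_def split: if_splits)
    fix g :: "'a \<Rightarrow> real"
    assume g: "\<forall>x\<in>B. g x = 0"
    show "energy f * sq_norm g \<le> energy g"
    proof (cases "sq_norm g > 0")
      case True
      let ?h = "\<lambda>x. if x \<in> verts G - B then g x / sqrt (sq_norm g) else 0"
      \<comment> \<open>Only values at vertices enter the energy, and \<open>g\<close> vanishes on
        \<open>B\<close>, so the cut-off in \<open>?h\<close> changes nothing beyond the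
        scaling.\<close>
      have "energy ?h = (\<Sum>x\<in>verts G. \<Sum>y\<in>nbrs x. (g x - g y)\<^sup>2 / sq_norm g) / 2"
        unfolding energy_def using g True
        by (intro arg_cong[where f = "\<lambda>s. s / 2"] sum.cong refl)
          (auto simp: nbrs_def power_divide simp flip: diff_divide_distrib)
      also have "\<dots> = energy g / sq_norm g"
        by (simp add: energy_def flip: sum_divide_distrib)
      finally have "energy f \<le> energy g / sq_norm g"
        using f(2)[OF normalised[OF True g]] by simp
      then show ?thesis using True by (simp add: field_simps)
    next
      case False
      moreover have "sq_norm g \<ge> 0" unfolding sq_norm_def by (simp add: sum_nonneg)
      moreover have "energy g \<ge> 0" unfolding energy_def by (simp add: sum_nonneg)
      ultimately show ?thesis by simp
    qed
  qed
qed

text \<open>\<open>LEAST\<close> over the reals is meaningful only once a least eigenvalue is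
  exhibited. The minimal energy is one: the minimiser is an eigenfunction, and every eigenvalue is
  the Rayleigh quotient of its own eigenfunction.\<close>

lemma
  assumes "verts G - B \<noteq> {}"
  shows dirichlet_lambda1_eigenvalue: "dirichlet_eigenvalue G B (dirichlet_lambda1 G B)"
    and dirichlet_lambda1_le_rayleigh:
      "\<And>g. \<forall>x\<in>B. g x = 0 \<Longrightarrow> dirichlet_lambda1 G B * sq_norm g \<le> energy g"
proof -
  obtain f where f: "\<forall>x\<in>B. f x = 0" "sq_norm f = 1"
    "\<And>g. \<forall>x\<in>B. g x = 0 \<Longrightarrow> energy f * sq_norm g \<le> energy g"
    using ex_minimiser[OF assms] by blast
  have "\<exists>x\<in>verts G. f x \<noteq> 0"
  proof (rule ccontr)
    assume "\<not> ?thesis"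
    then have "sq_norm f = 0" by (simp add: sq_norm_def)
    with f(2) show False by simp
  qed
  moreover have "\<forall>x\<in>verts G - B. laplacian f x = energy f * f x"
    using f by (intro ballI minimiser_eigenfunction[of B]) auto
  ultimately have ev: "dirichlet_eigenvalue G B (energy f)"
    using f(1) unfolding dirichlet_eigenvalue_iff by blast
  have "energy f \<le> l" if "dirichlet_eigenvalue G B l" for l
  proof -
    obtain g x where g: "x \<in> verts G" "g x \<noteq> 0" "\<forall>x\<in>B. g x = 0"
      "\<forall>x\<in>verts G - B. laplacian g x = l * g x"
      using \<open>dirichlet_eigenvalue G B l\<close> unfolding dirichlet_eigenvalue_iff by blast
    have "energy f * sq_norm g \<le> l * sq_norm g"
      using f(3)[OF g(3)] eigenfunction_energy[OF g(3,4)] by simp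
    then show ?thesis using sq_norm_pos[of x g] g(1,2) by simp
  qed
  with ev have "dirichlet_lambda1 G B = energy f"
    unfolding dirichlet_lambda1_def by (intro Least_equality)
  then show "dirichlet_eigenvalue G B (dirichlet_lambda1 G B)"
    and "\<And>g. \<forall>x\<in>B. g x = 0 \<Longrightarrow> dirichlet_lambda1 G B * sq_norm g \<le> energy g"
    using ev f(3) by auto
qed

end

subsection \<open>Paths in trees\<close>

context graph
begin

abbreviation (input) acyclic_graph :: bool where
  "acyclic_graph \<equiv> \<nexists>p. cycle p \<and> 3 \<le> length p"

text \<open>The ends are unordered so that an arc and its reverse count as the same edge.\<close>

definition edge :: "'b \<Rightarrow> 'a set" where
  "edge e = {tail G e, head G e}"

lemma ex_reverse_arc:
  assumes "e \<in> arcs G"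
  obtains e' where "e' \<in> arcs G" "tail G e' = head G e" "head G e' = tail G e"
proof -
  from sym_arcs assms obtain e' where "e' \<in> arcs G" "tail G e = head G e'" "head G e = tail G e'"
    unfolding symmetric_conv by blast
  then show ?thesis by (intro that[of e']) simp_all
qed

text \<open>The arc from \<open>b\<close> back to \<open>a\<close> closes the path to a cycle, which
  has at least three arcs as soon as \<open>p\<close> has two.\<close>

lemma apath_adjacent_ends:
  assumes acyclic_graph and p: "apath a p b" and "b \<rightarrow>\<^bsub>G\<^esub> a"
  shows "length p \<le> 1"
proof (rule ccontr)
  assume "\<not> length p \<le> 1"
  moreover obtain e where "e \<in> arcs G" "tail G e = b" "head G e = a"
    using \<open>b \<rightarrow>\<^bsub>G\<^esub> a\<close> by auto
  with p have "cycle (e # p)"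
    unfolding cycle_def apath_def by (intro exI[of _ b]) (simp add: awalk_Cons_iff)
  ultimately show False using \<open>acyclic_graph\<close> by force
qed

text \<open>A walk from \<open>a\<close> to \<open>b\<close> around the edge contains a simple path
  that also avoids it. By \<open>apath_adjacent_ends\<close> that path is at most a single arc,
  which would have to be the edge itself.\<close>

lemma edge_is_bridge:
  assumes acyclic_graph and "a \<rightarrow>\<^bsub>G\<^esub> b"
  shows "(a, b) \<notin> {(x, y). x \<rightarrow>\<^bsub>G\<^esub> y \<and> {x, y} \<noteq> {a, b}}\<^sup>*"
proof
  assume ab: "(a, b) \<in> {(x, y). x \<rightarrow>\<^bsub>G\<^esub> y \<and> {x, y} \<noteq> {a, b}}\<^sup>*"
  have "\<exists>q. awalk a q z \<and> (\<forall>e\<in>set q. edge e \<noteq> {a, b})"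
    if "(a, z) \<in> {(x, y). x \<rightarrow>\<^bsub>G\<^esub> y \<and> {x, y} \<noteq> {a, b}}\<^sup>*" for z
    using that
  proof (induct rule: rtrancl_induct)
    case base
    show ?case using adj_in_verts[OF \<open>a \<rightarrow>\<^bsub>G\<^esub> b\<close>]
      by (intro exI[of _ "[]"]) (simp add: awalk_Nil_iff)
  next
    case (step x y)
    from step.hyps(3) obtain q where q: "awalk a q x" "\<forall>e\<in>set q. edge e \<noteq> {a, b}" by blast
    from step.hyps(2) have "x \<rightarrow>\<^bsub>G\<^esub> y" "{x, y} \<noteq> {a, b}" by auto
    moreover from \<open>x \<rightarrow>\<^bsub>G\<^esub> y\<close> obtain e where e: "e \<in> arcs G" "tail G e = x" "head G e = y" by auto
    moreover have "awalk a (q @ [e]) y"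
      using q(1) arc_implies_awalk[OF e(1)] e by (auto intro: awalk_appendI)
    ultimately show ?case
      using q(2) by (intro exI[of _ "q @ [e]"]) (auto simp: edge_def)
  qed
  from this[OF ab] obtain q where q: "awalk a q b" "\<forall>e\<in>set q. edge e \<noteq> {a, b}" by blast
  define r where "r = awalk_to_apath q"
  have r: "apath a r b" "set r \<subseteq> set q"
    unfolding r_def using q(1) by (auto intro: apath_awalk_to_apath dest: awalk_to_apath_subset)
  then have "length r \<le> 1"
    using apath_adjacent_ends[OF assms(1)] dominates_sym[OF assms(2)] by blast
  then consider "r = []" | e where "r = [e]"
    by (cases r) auto
  then show False
  proof cases
    case 1
    with r(1) \<open>a \<rightarrow>\<^bsub>G\<^esub> b\<close> show False by (auto simp: apath_Nil_iff dest: adj_not_same)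
  next
    case 2
    with r have "edge e = {a, b}" by (auto simp: apath_simps edge_def)
    with 2 r(2) q(2) show False by auto
  qed
qed

text \<open>In the closure of a relation, reversing and concatenating walks become symmetry and
  transitivity.\<close>

lemma awalk_avoiding_edge:
  assumes "awalk x r y" and "S \<notin> edge ` set r"
  shows "(x, y) \<in> {(x, y). x \<rightarrow>\<^bsub>G\<^esub> y \<and> {x, y} \<noteq> S}\<^sup>*"
  using assms
proof (induct r arbitrary: x)
  case Nil
  then show ?case by (simp add: awalk_Nil_iff)
next
  case (Cons e r)
  then have "(head G e, y) \<in> {(x, y). x \<rightarrow>\<^bsub>G\<^esub> y \<and> {x, y} \<noteq> S}\<^sup>*"
    by (auto simp: awalk_Cons_iff)
  moreover have "(x, head G e) \<in> {(x, y). x \<rightarrow>\<^bsub>G\<^esub> y \<and> {x, y} \<noteq> S}"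
    using Cons.prems by (auto simp: awalk_Cons_iff edge_def dest: in_arcs_imp_in_arcs_ends)
  ultimately show ?case by (rule converse_rtrancl_into_rtrancl[rotated])
qed

text \<open>A repeated edge would bring the path back to the tail of its first occurrence.\<close>

lemma distinct_edges_apath: "apath u p v \<Longrightarrow> distinct (map edge p)"
proof (induct p arbitrary: u)
  case (Cons e p)
  then have p: "apath (head G e) p v" "tail G e \<notin> set (awalk_verts (head G e) p)"
    by (auto simp: apath_Cons_iff)
  have "edge e \<noteq> edge e'" if "e' \<in> set p" for e'
    using that p awalk_verts_arc1[OF that, of "head G e"] awalk_verts_arc2[OF _ that, of "head G e" v]
    by (auto simp: edge_def apath_def doubleton_eq_iff)
  with Cons.hyps[OF p(1)] show ?case by auto
qed simp

lemma apath_shortest: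
  assumes acyclic_graph and p: "apath u p v" and q: "awalk u q v"
  shows "length p \<le> length q"
proof -
  \<comment> \<open>Each edge of \<open>p\<close> is a bridge separating \<open>u\<close> from \<open>v\<close>, so \<open>q\<close> traverses it.\<close>
  have "edge e \<in> edge ` set q" if "e \<in> set p" for e
  proof (rule ccontr)
    assume nq: "edge e \<notin> edge ` set q"
    obtain p1 p2 where p12: "p = p1 @ e # p2" using \<open>e \<in> set p\<close> by (meson split_list)
    let ?a = "tail G e" and ?b = "head G e"
    let ?R = "{(x, y). x \<rightarrow>\<^bsub>G\<^esub> y \<and> {x, y} \<noteq> {?a, ?b}}"
    have "sym ?R" using dominates_sym by (auto simp: sym_def insert_commute)
    then have sym: "(y, x) \<in> ?R\<^sup>*" if "(x, y) \<in> ?R\<^sup>*" for x y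
      using that by (meson sym_rtrancl symD)
    have w: "awalk u p1 ?a" "awalk ?b p2 v" "e \<in> arcs G"
      using p p12 by (auto simp: apath_def awalk_Cons_iff)
    have "edge e \<notin> edge ` set p1" "edge e \<notin> edge ` set p2"
      using distinct_edges_apath[OF p] p12 by auto
    then have "(u, ?a) \<in> ?R\<^sup>*" "(?b, v) \<in> ?R\<^sup>*" "(u, v) \<in> ?R\<^sup>*"
      using awalk_avoiding_edge[OF w(1), of "edge e"] awalk_avoiding_edge[OF w(2), of "edge e"]
        awalk_avoiding_edge[OF q nq]
      by (simp_all add: edge_def)
    \<comment> \<open>The detour runs back along \<open>p1\<close>, then along \<open>q\<close>,
      then back along \<open>p2\<close>.\<close>
    then have "(?a, ?b) \<in> ?R\<^sup>*"
      using sym by (meson rtrancl_trans)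
    then show False
      using edge_is_bridge[OF assms(1) in_arcs_imp_in_arcs_ends[OF w(3)]] by blast
  qed
  then have "card (edge ` set p) \<le> card (edge ` set q)"
    by (intro card_mono) auto
  moreover have "card (edge ` set p) = length p"
    using distinct_card[OF distinct_edges_apath[OF p]] by simp
  moreover have "card (edge ` set q) \<le> length q"
    by (meson card_image_le card_length finite_set order_trans)
  ultimately show ?thesis by simp
qed

section \<open>Distances, the diameter and diametral paths\<close>

lemma graph_dist_apath:
  assumes acyclic_graph and "apath u p v"
  shows "graph_dist G u v = length p"
  unfolding graph_dist_def
proof (rule Least_equality)
  show "\<exists>q. awalk u q v \<and> length q = length p"
    using assms(2) by (auto simp: apath_def)
  show "length p \<le> k" if "\<exists>q. awalk u q v \<and> length q = k" for k
    using that apath_shortest[OF assms] by blast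
qed

lemma
  shows graph_dist_le_diameter:
      "\<And>u v. u \<in> verts G \<Longrightarrow> v \<in> verts G \<Longrightarrow> graph_dist G u v \<le> graph_diameter G"
    and graph_diameter_attained:
      "verts G \<noteq> {} \<Longrightarrow> \<exists>u\<in>verts G. \<exists>v\<in>verts G. graph_dist G u v = graph_diameter G"
proof -
  let ?S = "{graph_dist G u v | u v. u \<in> verts G \<and> v \<in> verts G}"
  have "?S = (\<lambda>(u, v). graph_dist G u v) ` (verts G \<times> verts G)" by auto
  then have fin: "finite ?S" by simp
  then show "graph_dist G u v \<le> graph_diameter G" if "u \<in> verts G" "v \<in> verts G" for u v
    unfolding graph_diameter_def using that by (intro Max_ge) auto
  assume "verts G \<noteq> {}"
  then have "?S \<noteq> {}" by auto
  from Max_in[OF fin this]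
  show "\<exists>u\<in>verts G. \<exists>v\<in>verts G. graph_dist G u v = graph_diameter G"
    unfolding graph_diameter_def by force
qed

lemma connected_ex_apath:
  assumes "Digraph_Component.connected G" and "u \<in> verts G" "v \<in> verts G"
  obtains p where "apath u p v"
proof -
  have "u \<rightarrow>\<^sup>* v"
    using symmetric_connected_imp_strongly_connected[OF sym_arcs assms(1)] assms(2,3) by auto
  then show ?thesis using that reachable_apath by blast
qed

lemma ex_diametral_path:
  assumes acyclic_graph and "Digraph_Component.connected G" and "verts G \<noteq> {}"
  obtains u p v where "diametral_path G u p v"
proof -
  obtain u v where uv: "u \<in> verts G" "v \<in> verts G" "graph_dist G u v = graph_diameter G"
    using graph_diameter_attained[OF assms(3)] by blast
  obtain p where "apath u p v" using connected_ex_apath[OF assms(2) uv(1,2)] .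
  with uv(3) graph_dist_apath[OF assms(1)] show ?thesis
    by (intro that) (auto simp: diametral_path_def)
qed

lemma interior_vertsI:
  assumes "e \<in> arcs G" "e' \<in> arcs G" "tail G e = x" "tail G e' = x" "head G e \<noteq> head G e'"
  shows "x \<in> interior_verts G"
proof -
  have "out_degree G x \<noteq> 1"
  proof
    assume "out_degree G x = 1"
    then obtain a where "out_arcs G x = {a}"
      unfolding out_degree_def using card_1_singletonE by blast
    moreover have "e \<in> out_arcs G x" "e' \<in> out_arcs G x" using assms by auto
    ultimately show False using assms(5) by auto
  qed
  then show ?thesis using assms tail_in_verts[OF assms(1)] by (auto simp: interior_verts_def leaves_def)
qed

text \<open>Without parallel arcs, a single neighbour means a single outgoing arc.\<close>

lemma leavesI:
  assumes "e \<in> arcs G" and "\<And>e'. e' \<in> arcs G \<Longrightarrow> tail G e' = tail G e \<Longrightarrow> head G e' = head G e"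
  shows "tail G e \<in> leaves G"
proof -
  have "out_arcs G (tail G e) = {e}"
  proof (rule set_eqI)
    fix e'
    show "e' \<in> out_arcs G (tail G e) \<longleftrightarrow> e' \<in> {e}"
      using assms(1) assms(2)[of e'] no_multi_arcs[of e' e] by (auto simp: arc_to_ends_def)
  qed
  then show ?thesis using assms(1) by (simp add: leaves_def out_degree_def)
qed

text \<open>The predecessor and the successor of \<open>x\<close> on a simple path are two different
  neighbours of \<open>x\<close>.\<close>

lemma apath_inner_vertex_interior:
  assumes p: "apath u p v" and x: "x \<in> set (awalk_verts u p)" "x \<noteq> u" "x \<noteq> v"
  shows "x \<in> interior_verts G"
proof -
  obtain q r where qr: "p = q @ r" "awalk u q x" "awalk x r v"
    using awalk_decomp[OF awalkI_apath[OF p] x(1)] by blast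
  have "q \<noteq> []" "r \<noteq> []" using qr x by (auto simp: awalk_Nil_iff)
  then obtain q' e e' r' where split: "q = q' @ [e]" "r = e' # r'"
    by (metis list.exhaust rev_exhaust)
  have e: "e \<in> arcs G" "e' \<in> arcs G" "head G e = x" "tail G e' = x"
    using qr split by (auto simp: awalk_Cons_iff awalk_Nil_iff)
  obtain f where f: "f \<in> arcs G" "tail G f = x" "head G f = tail G e"
    using ex_reverse_arc[OF e(1)] e by metis
  have "distinct (awalk_verts u (q' @ e # e' # r'))"
    using p qr split by (simp add: apath_def)
  moreover have "head G e' \<in> set (awalk_verts (head G e') r')"
    by (cases r') (use qr split in \<open>auto simp: awalk_Cons_iff\<close>)
  ultimately have "tail G e \<noteq> head G e'"
    using p qr split by (auto simp: apath_def awalk_verts_append2)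
  with interior_vertsI[OF f(1) e(2)] f e show ?thesis by simp
qed

text \<open>The equality of vertex sets carries the induction: it keeps \<open>u\<close> off the
  reversed remainder to which the last arc is appended.\<close>

lemma ex_reverse_apath:
  assumes "apath u p v"
  obtains q where "apath v q u" "length q = length p" "set (awalk_verts v q) = set (awalk_verts u p)"
proof -
  have "\<exists>q. apath v q u \<and> length q = length p \<and> set (awalk_verts v q) = set (awalk_verts u p)"
    using assms
  proof (induct p arbitrary: u)
    case Nil
    then show ?case by (auto simp: apath_Nil_iff)
  next
    case (Cons e p)
    then have e: "e \<in> arcs G" "tail G e = u" "apath (head G e) p v"
      "u \<notin> set (awalk_verts (head G e) p)"
      by (auto simp: apath_Cons_iff)
    obtain q where q: "apath v q (head G e)" "length q = length p"
      "set (awalk_verts v q) = set (awalk_verts (head G e) p)"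
      using Cons.hyps[OF e(3)] by blast
    obtain f where f: "f \<in> arcs G" "tail G f = head G e" "head G f = u"
      using ex_reverse_arc[OF e(1)] e(2) by metis
    have last: "awlast v q = head G e" using q(1) by (auto simp: apath_def)
    have "apath (head G e) [f] u"
      using f e(1,4) no_loops[OF f(1)] by (auto simp: apath_simps)
    then have "apath v (q @ [f]) u"
      using q e(4) last f by (auto simp: apath_append_iff)
    moreover have "set (awalk_verts v (q @ [f])) = insert u (set (awalk_verts v q))"
      using calculation last f by (auto simp: apath_def awalk_verts_append)
    ultimately show ?case
      using q e by (intro exI[of _ "q @ [f]"]) auto
  qed
  then show ?thesis using that by blast
qed

text \<open>A second neighbour of \<open>u\<close> would lie off the path by acyclicity. Prepending
  it would give a simple path, hence a distance, exceeding the diameter by one.\<close>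

lemma diametral_path_start_leaf:
  assumes acyclic_graph and d: "diametral_path G u p v" and "p \<noteq> []"
  shows "u \<in> leaves G"
proof -
  have p: "apath u p v" "length p = graph_diameter G" using d by (auto simp: diametral_path_def)
  obtain e p' where ep: "p = e # p'" using \<open>p \<noteq> []\<close> by (cases p) auto
  have e: "e \<in> arcs G" "tail G e = u" using p(1) ep by (auto simp: apath_Cons_iff)
  have "head G f = head G e" if f: "f \<in> arcs G" "tail G f = tail G e" for f
  proof (rule ccontr)
    assume ne: "head G f \<noteq> head G e"
    let ?w = "head G f"
    obtain g where g: "g \<in> arcs G" "tail G g = ?w" "head G g = u"
      using ex_reverse_arc[OF f(1)] f(2) e(2) by metis
    have "?w \<notin> set (awalk_verts u p)"
    proof
      assume "?w \<in> set (awalk_verts u p)"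
      then obtain q r where qr: "p = q @ r" "awalk u q ?w" "awalk ?w r v"
        using awalk_decomp[OF awalkI_apath[OF p(1)]] by blast
      then have q: "apath u q ?w" using p(1) by (auto simp: apath_append_iff)
      have "?w \<rightarrow>\<^bsub>G\<^esub> u" using in_arcs_imp_in_arcs_ends[OF g(1)] g by simp
      \<comment> \<open>The arc from \<open>?w\<close> to \<open>u\<close> would close the segment
        \<open>q\<close>, so \<open>?w\<close> is either \<open>u\<close> itself or the vertex right
        after it.\<close>
      with apath_adjacent_ends[OF assms(1) q] have "length q \<le> 1" by blast
      then consider "q = []" | a where "q = [a]" by (cases q) auto
      then show False
      proof cases
        case 1
        with q show False using no_loops[OF f(1)] f(2) e(2) by (auto simp: apath_Nil_iff)
      next
        case 2
        with qr ep ne show False by (auto simp: awalk_simps)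
      qed
    qed
    then have "apath ?w (g # p) v" using p(1) g by (simp add: apath_Cons_iff)
    from graph_dist_apath[OF assms(1) this] have "graph_dist G ?w v = Suc (graph_diameter G)"
      using p(2) by simp
    moreover have "graph_dist G ?w v \<le> graph_diameter G"
      using f p(1) by (intro graph_dist_le_diameter) (auto simp: apath_def)
    ultimately show False by simp
  qed
  then show ?thesis using leavesI[OF e(1)] e(2) by simp
qed

lemma diametral_path_ends_leaves:
  assumes acyclic_graph and d: "diametral_path G u p v" and "p \<noteq> []"
  shows "u \<in> leaves G" "v \<in> leaves G"
proof -
  show "u \<in> leaves G" using diametral_path_start_leaf[OF assms] .
  obtain q where "apath v q u" "length q = length p"
    using d ex_reverse_apath[of u p v] by (auto simp: diametral_path_def)
  with assms show "v \<in> leaves G"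
    by (intro diametral_path_start_leaf[of v q u]) (auto simp: diametral_path_def)
qed

text \<open>Of the \<open>D + 1\<close> vertices of a simple path with \<open>D\<close> arcs,
  exactly the two ends are leaves.\<close>

lemma diametral_path_inner:
  assumes acyclic_graph and d: "diametral_path G u p v" and "p \<noteq> []"
  shows "set (awalk_verts u p) \<inter> interior_verts G = set (awalk_verts u p) - {u, v}"
    and "card (set (awalk_verts u p) - {u, v}) = graph_diameter G - 1"
proof -
  have p: "apath u p v" "length p = graph_diameter G" using d by (auto simp: diametral_path_def)
  show "set (awalk_verts u p) \<inter> interior_verts G = set (awalk_verts u p) - {u, v}"
    using diametral_path_ends_leaves[OF assms] apath_inner_vertex_interior[OF p(1)]
    by (auto simp: interior_verts_def)
  have "{u, v} \<subseteq> set (awalk_verts u p)"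
    using p(1) by (auto simp: apath_def dest: hd_in_awalk_verts(1))
  moreover have "card {u, v} = 2"
    using apath_nonempty_ends[OF p(1) \<open>p \<noteq> []\<close>] by simp
  moreover have "card (set (awalk_verts u p)) = Suc (length p)"
    using p(1) by (simp add: apath_def distinct_card length_awalk_verts)
  ultimately show "card (set (awalk_verts u p) - {u, v}) = graph_diameter G - 1"
    using p(2) by (simp add: card_Diff_subset)
qed

lemma finite_interior_verts [simp]: "finite (interior_verts G)"
  by (simp add: interior_verts_def)

lemma card_interior_ge:
  assumes acyclic_graph and d: "diametral_path G u p v" and "p \<noteq> []"
  shows "graph_diameter G - 1 \<le> card (interior_verts G)"
  using card_mono[OF finite_interior_verts Int_lower2, of "set (awalk_verts u p)"]
  by (simp add: diametral_path_inner[OF assms])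

text \<open>The path already contains \<open>D - 1\<close> interior vertices, so equality leaves
  none outside it. As the left side does not mention the path, the right side holds for all
  diametral paths or for none.\<close>

lemma card_interior_eq_iff:
  assumes acyclic_graph and d: "diametral_path G u p v" and "p \<noteq> []"
  shows "card (interior_verts G) = graph_diameter G - 1 \<longleftrightarrow>
    interior_verts G \<subseteq> set (awalk_verts u p)"
proof -
  let ?I = "set (awalk_verts u p) \<inter> interior_verts G"
  have "card ?I = graph_diameter G - 1"
    using diametral_path_inner[OF assms] by simp
  moreover have "card ?I = card (interior_verts G) \<longleftrightarrow> ?I = interior_verts G"
    by (metis card_subset_eq finite_interior_verts inf_le2)
  ultimately show ?thesis by auto
qed

end

subsection \<open>Leaves and the indicator function of the interior\<close>

lemma sum_indicator_real:
  "finite A \<Longrightarrow> (\<Sum>x\<in>A. indicator B x :: real) = card (A \<inter> B)"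
  by (simp add: indicator_def)

context graph
begin

lemma leaves_subset_verts: "leaves G \<subseteq> verts G"
  by (auto simp: leaves_def)

lemma finite_leaves [simp]: "finite (leaves G)"
  using finite_subset[OF leaves_subset_verts] by simp

lemma verts_minus_leaves: "verts G - leaves G = interior_verts G"
  by (simp add: interior_verts_def)

lemma finite_leaf_neighbours [simp]: "finite (leaf_neighbours G x)"
  by (simp add: leaf_neighbours_def)

lemma leaf_neighbours_eq: "leaf_neighbours G x = nbrs x \<inter> leaves G"
  using leaves_subset_verts by (auto simp: leaf_neighbours_def nbrs_def)

lemma leaf_ex1_neighbour:
  assumes "x \<in> leaves G"
  shows "\<exists>!y. x \<rightarrow>\<^bsub>G\<^esub> y"
proof -
  have "card (out_arcs G x) = 1" using assms by (simp add: leaves_def out_degree_def)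
  then obtain e where "out_arcs G x = {e}" using card_1_singletonE by blast
  then have e: "e \<in> arcs G" "tail G e = x" "\<And>e'. e' \<in> arcs G \<Longrightarrow> tail G e' = x \<Longrightarrow> e' = e"
    by (auto simp: out_arcs_def)
  show ?thesis
  proof (rule ex1I)
    show "x \<rightarrow>\<^bsub>G\<^esub> head G e" using in_arcs_imp_in_arcs_ends[OF e(1)] e(2) by simp
    show "y = head G e" if "x \<rightarrow>\<^bsub>G\<^esub> y" for y
      using that e(3) by (auto simp: arcs_ends_conv)
  qed
qed

text \<open>Two adjacent leaves would form a whole connected component.\<close>

lemma leaf_neighbour_interior:
  assumes "Digraph_Component.connected G" and "3 \<le> card (verts G)"
    and x: "x \<in> leaves G" and xy: "x \<rightarrow>\<^bsub>G\<^esub> y"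
  shows "y \<in> interior_verts G"
proof (rule ccontr)
  assume "y \<notin> interior_verts G"
  then have y: "y \<in> leaves G"
    using adj_in_verts[OF xy] by (simp add: interior_verts_def)
  have closed: "b \<in> {x, y}" if "a \<in> {x, y}" "a \<rightarrow>\<^bsub>G\<^esub> b" for a b
    using that xy dominates_sym[OF xy] leaf_ex1_neighbour[OF x] leaf_ex1_neighbour[OF y] by blast
  have "z \<in> {x, y}" if "z \<in> verts G" for z
  proof -
    have "x \<rightarrow>\<^sup>* z"
      using symmetric_connected_imp_strongly_connected[OF sym_arcs assms(1)] that adj_in_verts[OF xy]
      by auto
    then show ?thesis
    proof (induct rule: reachable_induct)
      case (step a b)
      then show ?case using closed by blast
    qed simp
  qed
  then have "card (verts G) \<le> card {x, y}" by (intro card_mono) auto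
  also have "\<dots> \<le> 2" by (simp add: card_insert_if)
  finally show False using assms(2) by simp
qed

text \<open>Otherwise all distinct vertices are adjacent, and three of them form a simple path of
  two arcs, whose length is a distance. This makes the denominator \<open>D - 1\<close>
  positive.\<close>

lemma graph_diameter_ge_2:
  assumes acyclic_graph and "Digraph_Component.connected G" and "3 \<le> card (verts G)"
  shows "2 \<le> graph_diameter G"
proof (rule ccontr)
  assume small: "\<not> 2 \<le> graph_diameter G"
  have short: "length p \<le> 1" if "apath u p v" for u p v
  proof -
    have "length p = graph_dist G u v" using graph_dist_apath[OF assms(1) that] by simp
    also have "\<dots> \<le> graph_diameter G"
      using that by (intro graph_dist_le_diameter) (auto simp: apath_def)
    finally show ?thesis using small by simp
  qed
  have adj: "\<exists>e\<in>arcs G. tail G e = u \<and> head G e = v"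
    if uv: "u \<in> verts G" "v \<in> verts G" "u \<noteq> v" for u v
  proof -
    obtain p where p: "apath u p v" using connected_ex_apath[OF assms(2) uv(1,2)] .
    with short[OF p] uv(3) show ?thesis
      by (cases p) (auto simp: apath_simps)
  qed
  obtain S where "S \<subseteq> verts G" "card S = 3"
    using obtain_subset_with_card_n[OF assms(3)] by blast
  then obtain a b c where abc: "a \<in> verts G" "b \<in> verts G" "c \<in> verts G" "a \<noteq> b" "b \<noteq> c" "a \<noteq> c"
    by (auto simp: card_3_iff)
  obtain e where e: "e \<in> arcs G" "tail G e = a" "head G e = b" using adj abc by metis
  obtain f where f: "f \<in> arcs G" "tail G f = b" "head G f = c" using adj abc by metis
  have "apath a [e, f] c" using e f abc by (simp add: apath_simps)
  then show False using short by fastforce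
qed

text \<open>Each leaf has exactly one neighbour, and that one is interior, so the sets of leaf
  neighbours partition the leaves.\<close>

lemma card_leaves_eq_sum:
  assumes "Digraph_Component.connected G" and "3 \<le> card (verts G)"
  shows "card (leaves G) = (\<Sum>x\<in>interior_verts G. card (leaf_neighbours G x))"
proof -
  have "leaves G = (\<Union>x\<in>interior_verts G. leaf_neighbours G x)"
  proof
    show "leaves G \<subseteq> (\<Union>x\<in>interior_verts G. leaf_neighbours G x)"
    proof
      fix y assume y: "y \<in> leaves G"
      then obtain x where "y \<rightarrow>\<^bsub>G\<^esub> x" using leaf_ex1_neighbour by blast
      then show "y \<in> (\<Union>x\<in>interior_verts G. leaf_neighbours G x)"
        using leaf_neighbour_interior[OF assms y] dominates_sym y
        by (auto simp: leaf_neighbours_def)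
    qed
  qed (auto simp: leaf_neighbours_def)
  moreover have "leaf_neighbours G x \<inter> leaf_neighbours G x' = {}" if "x \<noteq> x'" for x x'
    using that leaf_ex1_neighbour dominates_sym unfolding leaf_neighbours_def by blast
  ultimately show ?thesis by (simp add: card_UN_disjoint)
qed

lemma laplacian_indicator_interior:
  assumes "x \<in> interior_verts G"
  shows "laplacian (indicator (interior_verts G)) x = card (leaf_neighbours G x)"
proof -
  have "laplacian (indicator (interior_verts G)) x = (\<Sum>y\<in>nbrs x. indicator (leaves G) y)"
    unfolding laplacian_def using assms
    by (intro sum.cong) (auto simp: nbrs_def interior_verts_def indicator_def)
  then show ?thesis by (simp add: sum_indicator_real leaf_neighbours_eq)
qed

lemma sq_norm_indicator_interior:
  "sq_norm (indicator (interior_verts G)) = card (interior_verts G)"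
proof -
  have "sq_norm (indicator (interior_verts G)) = (\<Sum>x\<in>verts G. indicator (interior_verts G) x)"
    unfolding sq_norm_def by (intro sum.cong) (auto simp: indicator_def)
  also have "\<dots> = card (verts G \<inter> interior_verts G)"
    by (simp add: sum_indicator_real)
  also have "verts G \<inter> interior_verts G = interior_verts G"
    by (auto simp: interior_verts_def)
  finally show ?thesis .
qed

lemma energy_indicator_interior:
  "energy (indicator (interior_verts G)) = (\<Sum>x\<in>interior_verts G. card (leaf_neighbours G x))"
proof -
  have "energy (indicator (interior_verts G)) =
      (\<Sum>x\<in>interior_verts G. indicator (interior_verts G) x * laplacian (indicator (interior_verts G)) x)"
    unfolding energy_eq_sum_laplacian
    by (intro sum.mono_neutral_right) (auto simp: interior_verts_def)
  then show ?thesis by (simp add: laplacian_indicator_interior)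
qed

text \<open>The edges between interior vertices are dropped; an edge from \<open>x\<close> to a leaf
  contributes \<open>(g x)\<^sup>2\<close>.\<close>

lemma energy_ge_leaf_edges:
  fixes g :: "'a \<Rightarrow> real"
  assumes "\<forall>x\<in>leaves G. g x = 0"
  shows "(\<Sum>x\<in>interior_verts G. card (leaf_neighbours G x) * (g x)\<^sup>2) \<le> energy g"
proof -
  \<comment> \<open>In the energy each edge occurs in both directions, hence the symmetrisation of \<open>\<phi>\<close>.\<close>
  define \<phi> :: "'a \<Rightarrow> 'a \<Rightarrow> real" where "\<phi> x y = (if x \<in> interior_verts G then indicator (leaves G) y * (g x)\<^sup>2 else 0)" for x y
  have "(\<Sum>x\<in>interior_verts G. card (leaf_neighbours G x) * (g x)\<^sup>2) =
      (\<Sum>x\<in>interior_verts G. \<Sum>y\<in>nbrs x. \<phi> x y)"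
    by (simp add: \<phi>_def leaf_neighbours_eq sum_indicator_real flip: sum_distrib_right)
  also have "\<dots> = (\<Sum>x\<in>verts G. \<Sum>y\<in>nbrs x. \<phi> x y)"
    by (intro sum.mono_neutral_left) (auto simp: interior_verts_def \<phi>_def)
  also have "\<dots> = ((\<Sum>x\<in>verts G. \<Sum>y\<in>nbrs x. \<phi> x y) + (\<Sum>x\<in>verts G. \<Sum>y\<in>nbrs x. \<phi> y x)) / 2"
    by (subst (3) sum_nbrs_swap) simp
  also have "\<dots> = (\<Sum>x\<in>verts G. \<Sum>y\<in>nbrs x. \<phi> x y + \<phi> y x) / 2"
    by (simp add: sum.distrib)
  \<comment> \<open>Termwise, this is an equality if one end is a leaf and the other interior;
    otherwise the left side is zero.\<close>
  also have "\<dots> \<le> energy g"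
    unfolding energy_def using assms
    by (intro divide_right_mono sum_mono) (auto simp: \<phi>_def interior_verts_def indicator_def)
  finally show ?thesis .
qed

text \<open>This is the bound with the number of interior vertices in place of \<open>D - 1\<close>;
  the diameter enters only by comparing these two numbers.\<close>

lemma dirichlet_lambda1_leaves_le:
  assumes "interior_verts G \<noteq> {}"
    and "Digraph_Component.connected G" and "3 \<le> card (verts G)"
  shows "dirichlet_lambda1 G (leaves G) \<le> card (verts G) / card (interior_verts G) - 1"
    and "dirichlet_lambda1 G (leaves G) = card (verts G) / card (interior_verts G) - 1 \<longleftrightarrow>
      (\<exists>k. \<forall>x\<in>interior_verts G. card (leaf_neighbours G x) = k)"
proof -
  let ?l = "dirichlet_lambda1 G (leaves G)" and ?I = "interior_verts G"
  let ?f = "indicator ?I :: 'a \<Rightarrow> real"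
  have I: "card ?I > 0" using assms(1) by (simp add: card_gt_0_iff)
  have ne: "verts G - leaves G \<noteq> {}" using assms(1) by (simp add: verts_minus_leaves)
  have "card (leaves G) + card ?I = card (verts G)"
    using card_Un_disjoint[of "leaves G" ?I] leaves_subset_verts
    by (simp add: interior_verts_def Un_absorb1)
  moreover have E_leaves: "energy ?f = card (leaves G)"
    by (simp add: energy_indicator_interior card_leaves_eq_sum[OF assms(2,3)])
  ultimately have "energy ?f = real (card (verts G)) - card ?I"
    by simp
  then have E: "energy ?f = (card (verts G) / card ?I - 1) * sq_norm ?f"
    using assms(1) by (simp add: sq_norm_indicator_interior left_diff_distrib)
  have f0: "\<forall>x\<in>leaves G. ?f x = 0" by (simp add: interior_verts_def)
  have f_pos: "sq_norm ?f > 0" using I by (simp add: sq_norm_indicator_interior)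
  have "?l * sq_norm ?f \<le> energy ?f"
    by (rule dirichlet_lambda1_le_rayleigh[OF ne f0])
  then show le: "?l \<le> card (verts G) / card ?I - 1"
    unfolding E using f_pos by simp
  show "?l = card (verts G) / card ?I - 1 \<longleftrightarrow> (\<exists>k. \<forall>x\<in>?I. card (leaf_neighbours G x) = k)"
  proof
    assume eq: "?l = card (verts G) / card ?I - 1"
    have "real (card (leaf_neighbours G x)) = ?l" if "x \<in> ?I" for x
      using minimiser_eigenfunction[OF dirichlet_lambda1_le_rayleigh[OF ne] f0, of x] that E eq
      by (simp add: laplacian_indicator_interior verts_minus_leaves)
    then show "\<exists>k. \<forall>x\<in>?I. card (leaf_neighbours G x) = k"
      by (metis of_nat_eq_iff)
  next
    assume "\<exists>k. \<forall>x\<in>?I. card (leaf_neighbours G x) = k"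
    then obtain k where k: "\<forall>x\<in>?I. card (leaf_neighbours G x) = k" ..
    obtain g z where g: "z \<in> verts G" "g z \<noteq> 0" "\<forall>x\<in>leaves G. g x = 0"
      "\<forall>x\<in>verts G - leaves G. laplacian g x = ?l * g x"
      using dirichlet_lambda1_eigenvalue[OF ne] unfolding dirichlet_eigenvalue_iff by blast
    have "(\<Sum>x\<in>?I. card (leaf_neighbours G x) * (g x)\<^sup>2) = k * (\<Sum>x\<in>?I. (g x)\<^sup>2)"
      using k by (simp add: sum_distrib_left)
    also have "(\<Sum>x\<in>?I. (g x)\<^sup>2) = sq_norm g"
      unfolding sq_norm_def using g(3)
      by (intro sum.mono_neutral_left) (auto simp: interior_verts_def)
    finally have "k * sq_norm g \<le> ?l * sq_norm g"
      using energy_ge_leaf_edges[OF g(3)] eigenfunction_energy[OF g(3,4)] by simp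
    then have "k \<le> ?l" using sq_norm_pos[of z g] g(1,2) by simp
    \<comment> \<open>Both \<open>k\<close> and the upper bound are the Rayleigh quotient of
      \<open>?f\<close>, hence equal.\<close>
    moreover have "energy ?f = k * sq_norm ?f"
      using k by (simp add: energy_indicator_interior sq_norm_indicator_interior)
    then have "k = card (verts G) / card ?I - 1"
      using E f_pos by simp
    ultimately show "?l = card (verts G) / card ?I - 1" using le by simp
  qed
qed

end

section \<open>The bound in terms of the diameter\<close>

theorem corollary1p6:
  fixes T :: "('a, 'b) pre_digraph" and n D :: nat
  assumes "undirected_tree T"
    and "n = card (verts T)" and "n \<ge> 3"
    and "D = graph_diameter T"
  shows "dirichlet_lambda1 T (leaves T) \<le> real n / (real D - 1) - 1 \<and>
    (dirichlet_lambda1 T (leaves T) = real n / (real D - 1) - 1 \<longleftrightarrow>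
      (\<exists>u p v. diametral_path T u p v \<and>
         interior_verts T \<subseteq> set (pre_digraph.awalk_verts T u p)) \<and>
      (\<exists>k. \<forall>x \<in> interior_verts T. card (leaf_neighbours T x) = k))"
proof -
  interpret graph T using assms(1) by (simp add: undirected_tree_def)
  have con: "Digraph_Component.connected T" and acyclic: "\<nexists>p. cycle p \<and> 3 \<le> length p"
    using assms(1) by (auto simp: undirected_tree_def)
  have n3: "3 \<le> card (verts T)" using assms by simp
  let ?l = "dirichlet_lambda1 T (leaves T)" and ?I = "interior_verts T"
  have D: "2 \<le> D" using graph_diameter_ge_2[OF acyclic con n3] assms(4) by simp
  have p_ne: "p \<noteq> []" if "diametral_path T u p v" for u p v
    using that D assms(4) by (auto simp: diametral_path_def)
  have on_path: "card ?I = D - 1 \<longleftrightarrow> ?I \<subseteq> set (awalk_verts u p)" if "diametral_path T u p v" for u p v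
    using card_interior_eq_iff[OF acyclic that p_ne[OF that]] assms(4) by simp
  have "verts T \<noteq> {}" using n3 by auto
  then obtain u p v where d: "diametral_path T u p v"
    using ex_diametral_path[OF acyclic con] by blast
  have ge: "D - 1 \<le> card ?I"
    using card_interior_ge[OF acyclic d p_ne[OF d]] assms(4) by simp
  then have I: "?I \<noteq> {}" using D by auto
  note l = dirichlet_lambda1_leaves_le[OF I con n3, folded assms(2)]
  \<comment> \<open>Truncated subtraction agrees with the real one because \<open>D\<close> is at
    least 2.\<close>
  have D': "real D - 1 = real (D - 1)" "real (D - 1) > 0" using D by auto
  have le: "n / card ?I \<le> n / (real D - 1)"
    unfolding D' using ge D'(2) by (intro divide_left_mono mult_pos_pos) auto
  have eq_iff: "real n / card ?I = n / (real D - 1) \<longleftrightarrow> card ?I = D - 1"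
    unfolding D' using ge D'(2) assms(3) by (auto simp: frac_eq_eq)
  \<comment> \<open>The bound is a chain of two inequalities through \<open>n / card ?I - 1\<close>,
    so equality of its ends means equality in both.\<close>
  have "?l = n / (real D - 1) - 1 \<longleftrightarrow>
      card ?I = D - 1 \<and> (\<exists>k. \<forall>x\<in>?I. card (leaf_neighbours T x) = k)"
    using l(1) le unfolding l(2)[symmetric] eq_iff[symmetric] by auto
  moreover have "card ?I = D - 1 \<longleftrightarrow>
      (\<exists>u p v. diametral_path T u p v \<and> ?I \<subseteq> set (awalk_verts u p))"
    using on_path d by blast
  ultimately show ?thesis using l(1) le by simp
qed

end
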